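(* Consider on $\mathbb{R}^6(\boldsymbol M,\boldsymbol\gamma)$ the system $$\dot{\boldsymbol M}=(\boldsymbol M-S\boldsymbol\gamma)\times\frac{\partial H}{\partial\boldsymbol M}+\boldsymbol\gamma\times\frac{\partial H}{\partial\boldsymbol\gamma},\qquad \dot{\boldsymbol\gamma}=\boldsymbol\gamma\times\frac{\partial H}{\partial\boldsymbol M},$$ where $H(\boldsymbol M,\boldsymbol\gamma)$ is an arbitrary function which is quadratic and non-degenerate in $\boldsymbol M$, and $S(\boldsymbol M,\boldsymbol\gamma)=(\boldsymbol K(\boldsymbol\gamma),\boldsymbol M)$ is linear in $\boldsymbol M$. If the system admits an invariant measure $\mu=\rho(\boldsymbol\gamma)\,d\boldsymbol M\,d\boldsymbol\gamma$ with density depending only on $\boldsymbol\gamma$, then it can be represented in the conformally Hamiltonian form $$\dot{\boldsymbol x}=\rho(\boldsymbol\gamma)\,\mathbf P(\boldsymbol x)\,\frac{\partial H}{\partial\boldsymbol x},\qquad \boldsymbol x=(\boldsymbol M,\boldsymbol\gamma),$$ where $\mathbf P(\boldsymbol x)=\rho^{-1}(\boldsymbol\gamma)\,\mathbf P_0(\boldsymbol x)$, $$\mathbf P_0=\begin{pmatrix}\mathbf M&\boldsymbol\Gamma\\ \boldsymbol\Gamma&0\end{pmatrix}-S(\boldsymbol x)\begin{pmatrix}\boldsymbol\Gamma&0\\ 0&0\end{pmatrix},$$ is a Poisson structure of rank $4$ with the Casimir functions $$F_1=\boldsymbol\gamma^2,\qquad F_2=(\boldsymbol M,\boldsymbol\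gamma).$$
   Context: $(\cdot,\cdot)$ and $\times$ are the standard inner and cross products on $\mathbb{R}^3$; $\boldsymbol M=(M_1,M_2,M_3)$, $\boldsymbol\gamma=(\gamma_1,\gamma_2,\gamma_3)$, and $$\mathbf M=\begin{pmatrix}0&-M_3&M_2\\ M_3&0&-M_1\\ -M_2&M_1&0\end{pmatrix},\qquad \boldsymbol\Gamma=\begin{pmatrix}0&-\gamma_3&\gamma_2\\ \gamma_3&0&-\gamma_1\\ -\gamma_2&\gamma_1&0\end{pmatrix}.$$ All functions ($H$, $\boldsymbol K:\mathbb{R}^3\to\mathbb{R}^3$, $\rho$) are smooth, and $\rho>0$. "Quadratic and non-degenerate in $\boldsymbol M$" means that for each $\boldsymbol\gamma$ the function $H(\cdot,\boldsymbol\gamma)$ is a polynomial of degree two in $\boldsymbol M$ whose quadratic part is a non-degenerate quadratic form. The measure $\mu$ is invariant if $\mathrm{div}(\rho\boldsymbol V)=0$ on $\mathbb{R}^6$, where $\boldsymbol V$ is the vector field of the system. A skew-symmetric matrix function $\mathbf P(\boldsymbol x)$ is a Poisson structure if the bracket $\{F,G\}=\big(\frac{\partial F}{\partial\boldsymbol x},\mathbf P\frac{\partial G}{\partial\boldsymbol x}\big)$ satisfies the Jacobi identity; its rank is the maximal (generic) rank of the matrix $\mathbf P(\boldsymbol x)$; a Casimir function is a function $F$ with $\mathbf P\frac{\partial F}{\partial\boldsymbol x}=0$. *)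

theory Defs
  imports "HOL-Analysis.Analysis"
begin

text \<open>Phase space: vectors of six components, indexed by the disjoint sum of two copies
  of the index type of \<open>real^3\<close>; \<open>Inl i\<close> is the index of \<open>M\<^sub>i\<close> and \<open>Inr i\<close> that of \<open>\<gamma>\<^sub>i\<close>.\<close>

type_synonym phase = "real^(3 + 3)"

definition join :: "real^3 \<Rightarrow> real^3 \<Rightarrow> phase" where
  "join M \<gamma> = (\<chi> k. case k of Inl i \<Rightarrow> M $ i | Inr i \<Rightarrow> \<gamma> $ i)"

definition M_of :: "phase \<Rightarrow> real^3" where
  "M_of x = (\<chi> i. x $ Inl i)"

definition gamma_of :: "phase \<Rightarrow> real^3" where
  "gamma_of x = (\<chi> i. x $ Inr i)"

lemma join_parts [simp]:
  "M_of (join M \<gamma>) = M" "gamma_of (join M \<gamma>) = \<gamma>" "join (M_of x) (gamma_of x) = x"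
  by (simp_all add: join_def M_of_def gamma_of_def vec_eq_iff split: sum.splits)

text \<open>\<open>C_diff n f\<close>: all iterated directional derivatives of \<open>f\<close> of order up to \<open>n\<close> exist in
  the Frechet sense and are continuous. On a finite-dimensional domain this is \<open>C\<^sup>n\<close>.\<close>

primrec C_diff :: "nat \<Rightarrow> ('a::euclidean_space \<Rightarrow> 'b::real_normed_vector) \<Rightarrow> bool" where
  "C_diff 0 f \<longleftrightarrow> continuous_on UNIV f"
| "C_diff (Suc n) f \<longleftrightarrow>
     f differentiable_on UNIV \<and> (\<forall>v. C_diff n (\<lambda>x. frechet_derivative f (at x) v))"

definition smooth :: "('a::euclidean_space \<Rightarrow> 'b::real_normed_vector) \<Rightarrow> bool" where
  "smooth f \<longleftrightarrow> (\<forall>n. C_diff n f)"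

definition grad :: "(real^'n \<Rightarrow> real) \<Rightarrow> real^'n \<Rightarrow> real^'n" where
  "grad F x = (\<chi> i. frechet_derivative F (at x) (axis i 1))"

definition divergence :: "(real^'n \<Rightarrow> real^'n) \<Rightarrow> real^'n \<Rightarrow> real" where
  "divergence V x = (\<Sum>i\<in>UNIV. frechet_derivative (\<lambda>y. V y $ i) (at x) (axis i 1))"

definition grad_M :: "(phase \<Rightarrow> real) \<Rightarrow> phase \<Rightarrow> real^3" where
  "grad_M H x = M_of (grad H x)"

definition grad_gamma :: "(phase \<Rightarrow> real) \<Rightarrow> phase \<Rightarrow> real^3" where
  "grad_gamma H x = gamma_of (grad H x)"

definition nondegenerate_quadratic :: "(real^'n \<Rightarrow> real) \<Rightarrow> bool" where
  "nondegenerate_quadratic q \<longleftrightarrow>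
     (\<exists>(A :: real^'n^'n) b c. transpose A = A \<and> det A \<noteq> 0 \<and>
        (\<forall>v. q v = v \<bullet> (A *v v) + b \<bullet> v + c))"

definition S_fun :: "(real^3 \<Rightarrow> real^3) \<Rightarrow> phase \<Rightarrow> real" where
  "S_fun K x = K (gamma_of x) \<bullet> M_of x"

definition vfield :: "(real^3 \<Rightarrow> real^3) \<Rightarrow> (phase \<Rightarrow> real) \<Rightarrow> phase \<Rightarrow> phase" where
  "vfield K H x =
     (let M = M_of x; \<gamma> = gamma_of x in
      join (cross3 (M - S_fun K x *\<^sub>R \<gamma>) (grad_M H x) + cross3 \<gamma> (grad_gamma H x))
           (cross3 \<gamma> (grad_M H x)))"

definition invariant_density :: "(real^'n \<Rightarrow> real^'n) \<Rightarrow> (real^'n \<Rightarrow> real) \<Rightarrow> bool" where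
  "invariant_density V \<rho> \<longleftrightarrow> (\<forall>x. divergence (\<lambda>y. \<rho> y *\<^sub>R V y) x = 0)"

definition bracket ::
  "(real^'n \<Rightarrow> real^'n^'n) \<Rightarrow> (real^'n \<Rightarrow> real) \<Rightarrow> (real^'n \<Rightarrow> real) \<Rightarrow> real^'n \<Rightarrow> real" where
  "bracket P F G x = grad F x \<bullet> (P x *v grad G x)"

definition poisson_structure :: "(real^'n \<Rightarrow> real^'n^'n) \<Rightarrow> bool" where
  "poisson_structure P \<longleftrightarrow>
     smooth P \<and>
     (\<forall>x. transpose (P x) = - P x) \<and>
     (\<forall>F G H. smooth F \<and> smooth G \<and> smooth H \<longrightarrow>
        (\<forall>x. bracket P F (bracket P G H) x + bracket P G (bracket P H F) x
             + bracket P H (bracket P F G) x = 0))"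

definition poisson_rank :: "(real^'n \<Rightarrow> real^'n^'n) \<Rightarrow> nat" where
  "poisson_rank P = Max (range (\<lambda>x. rank (P x)))"

definition casimir :: "(real^'n \<Rightarrow> real^'n^'n) \<Rightarrow> (real^'n \<Rightarrow> real) \<Rightarrow> bool" where
  "casimir P F \<longleftrightarrow> smooth F \<and> (\<forall>x. P x *v grad F x = 0)"

definition hat :: "real^3 \<Rightarrow> real^3^3" where
  "hat v = vector [vector [0, - (v$3), v$2],
                   vector [v$3, 0, - (v$1)],
                   vector [- (v$2), v$1, 0]]"

lemma hat_mult: "hat v *v w = cross3 v w"
  by (simp add: hat_def cross3_def vec_eq_iff forall_3 matrix_vector_mult_def sum_3)

definition block :: "real^3^3 \<Rightarrow> real^3^3 \<Rightarrow> real^3^3 \<Rightarrow> real^3^3 \<Rightarrow> real^(3 + 3)^(3 + 3)" where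
  "block A B C D = (\<chi> k l.
     case (k, l) of
       (Inl i, Inl j) \<Rightarrow> A $ i $ j | (Inl i, Inr j) \<Rightarrow> B $ i $ j
     | (Inr i, Inl j) \<Rightarrow> C $ i $ j | (Inr i, Inr j) \<Rightarrow> D $ i $ j)"

definition P0 :: "(real^3 \<Rightarrow> real^3) \<Rightarrow> phase \<Rightarrow> real^(3 + 3)^(3 + 3)" where
  "P0 K x =
     block (hat (M_of x)) (hat (gamma_of x)) (hat (gamma_of x)) 0
     - S_fun K x *\<^sub>R block (hat (gamma_of x)) 0 0 0"

definition P_tensor ::
  "(real^3 \<Rightarrow> real^3) \<Rightarrow> (real^3 \<Rightarrow> real) \<Rightarrow> phase \<Rightarrow> real^(3 + 3)^(3 + 3)" where
  "P_tensor K \<rho> x = inverse (\<rho> (gamma_of x)) *\<^sub>R P0 K x"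

end

theory Submission
  imports Defs
begin

text \<open>Since the canonical second-order terms cancel, the divergence of \<open>\<rho> V\<close> equals
  \<open>(\<nabla>\<rho> - \<rho> K, \<gamma> \<times> \<partial>H/\<partial>M)\<close>. Non-degeneracy of \<open>H\<close> makes \<open>\<partial>H/\<partial>M\<close>
  arbitrary at each \<open>\<gamma>\<close>, so invariance of the measure means
  \<open>(\<nabla>\<rho> - \<rho> K) \<times> \<gamma> = 0\<close>. This is exactly what makes the terms of the Jacobi identity
  that are linear in \<open>K\<close> cancel against those produced by the conformal factor \<open>1/\<rho>\<close>; the
  terms containing the derivative of \<open>K\<close> cancel unconditionally. The rank is at most 4 because
  a skew matrix with two independent kernel vectors loses two dimensions, and it is 4 at
  \<open>M = 0\<close>, \<open>\<gamma> = e\<^sub>1\<close>.\<close>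

subsection \<open>Calculus of smooth functions\<close>

lemma C_diff_SucD: "C_diff (Suc n) f \<Longrightarrow> C_diff n f"
proof (induction n arbitrary: f)
  case 0
  then show ?case by (simp add: differentiable_imp_continuous_on)
next
  case (Suc n)
  then show ?case by (metis C_diff.simps(2))
qed

lemma C_diff_const: "C_diff n (\<lambda>x. c)"
  by (induction n arbitrary: c) simp_all

lemma frechet_derivativeI: "(f has_derivative f') (at x) \<Longrightarrow> frechet_derivative f (at x) = f'"
  by (metis frechet_derivative_at)

text \<open>Frechet derivatives at a point are unique, so exhibiting any derivative
  \<open>f'\<close> pins down \<open>frechet_derivative\<close>; the closure lemmas below reduce to
  naming one.\<close>

lemma C_diff_SucI:
  assumes "\<And>x. (f has_derivative f' x) (at x)" and "\<And>v. C_diff n (\<lambda>x. f' x v)"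
  shows "C_diff (Suc n) f"
proof -
  have "frechet_derivative f (at x) = f' x" for x
    using assms(1) by (rule frechet_derivativeI)
  then show ?thesis
    using assms by (auto simp: differentiable_on_def intro: differentiableI)
qed

lemma C_diff_Suc_has_derivative:
  assumes "C_diff (Suc n) f"
  shows "(f has_derivative frechet_derivative f (at x)) (at x)"
  using assms by (simp add: differentiable_on_def frechet_derivative_works)

lemma C_diff_bounded_linear: "bounded_linear f \<Longrightarrow> C_diff n f"
proof (cases n)
  case 0
  then show "bounded_linear f \<Longrightarrow> C_diff n f" by (simp add: linear_continuous_on)
next
  case (Suc m)
  assume "bounded_linear f"
  then have "C_diff (Suc m) f"
    by (intro C_diff_SucI[where f' = "\<lambda>_. f"] C_diff_const bounded_linear_imp_has_derivative)
  then show ?thesis using Suc by simp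
qed

lemma C_diff_add: "C_diff n f \<Longrightarrow> C_diff n g \<Longrightarrow> C_diff n (\<lambda>x. f x + g x)"
proof (induction n arbitrary: f g)
  case 0
  then show ?case by (simp add: continuous_on_add)
next
  case (Suc n)
  show ?case
    by (rule C_diff_SucI[where f' = "\<lambda>x v. frechet_derivative f (at x) v + frechet_derivative g (at x) v"])
      (use Suc.IH Suc.prems has_derivative_add[OF C_diff_Suc_has_derivative[OF Suc.prems(1)]
        C_diff_Suc_has_derivative[OF Suc.prems(2)]] in auto)
qed

lemma C_diff_compose_linear:
  fixes L :: "'a::euclidean_space \<Rightarrow> 'b::euclidean_space"
  assumes "bounded_linear L"
  shows "C_diff n f \<Longrightarrow> C_diff n (\<lambda>x. f (L x))"
proof (induction n arbitrary: f)
  case 0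
  then show ?case
    using continuous_on_compose2[OF _ linear_continuous_on[OF assms], of UNIV f UNIV] by simp
next
  case (Suc n)
  have "((\<lambda>x. f (L x)) has_derivative (\<lambda>v. frechet_derivative f (at (L x)) (L v))) (at x)" for x
    using has_derivative_compose[OF bounded_linear_imp_has_derivative[OF assms]
        C_diff_Suc_has_derivative[OF Suc.prems]] .
  then show ?case
    by (rule C_diff_SucI) (use Suc in auto)
qed

text \<open>One induction for an arbitrary product serves multiplication, scaling and the inner
  product. The Leibniz rule leaves one factor undifferentiated, so the step also needs the factors
  themselves at order \<open>n\<close>.\<close>

lemma C_diff_bilinear:
  assumes "bounded_bilinear p"
  shows "C_diff n f \<Longrightarrow> C_diff n g \<Longrightarrow> C_diff n (\<lambda>x. p (f x) (g x))"
proof (induction n arbitrary: f g)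
  case 0
  then show ?case by (simp add: bounded_bilinear.continuous_on[OF assms])
next
  case (Suc n)
  have "((\<lambda>x. p (f x) (g x)) has_derivative
      (\<lambda>v. p (f x) (frechet_derivative g (at x) v) + p (frechet_derivative f (at x) v) (g x))) (at x)" for x
    using bounded_bilinear.FDERIV[OF assms C_diff_Suc_has_derivative[OF Suc.prems(1)]
        C_diff_Suc_has_derivative[OF Suc.prems(2)]] .
  then show ?case
    by (rule C_diff_SucI)
      (use Suc C_diff_SucD[OF Suc.prems(1)] C_diff_SucD[OF Suc.prems(2)]
        in \<open>auto intro!: C_diff_add\<close>)
qed

lemma C_diff_inverse:
  fixes f :: "'a::euclidean_space \<Rightarrow> real"
  assumes "\<And>x. f x \<noteq> 0"
  shows "C_diff n f \<Longrightarrow> C_diff n (\<lambda>x. inverse (f x))"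
proof (induction n)
  case 0
  then show ?case using assms by (simp add: continuous_on_inverse)
next
  case (Suc n)
  \<comment> \<open>The derivative of \<open>1/f\<close> contains \<open>1/f\<close> again; the
    induction hypothesis supplies that factor at order \<open>n\<close>.\<close>
  have *: "C_diff n (\<lambda>x. inverse (f x))"
    using Suc C_diff_SucD by blast
  have "C_diff n (\<lambda>x. - 1 * ((inverse (f x) * frechet_derivative f (at x) v) * inverse (f x)))" for v
    using Suc.prems * by (intro C_diff_bilinear[OF bounded_bilinear_mult] C_diff_const) auto
  moreover have "((\<lambda>x. inverse (f x)) has_derivative
      (\<lambda>v. - 1 * ((inverse (f x) * frechet_derivative f (at x) v) * inverse (f x)))) (at x)" for x
    using Deriv.has_derivative_inverse[OF assms C_diff_Suc_has_derivative[OF Suc.prems]]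
    by simp
  ultimately show ?case by (rule C_diff_SucI[rotated])
qed

section \<open>Derivatives of smooth functions and the symmetry of second derivatives\<close>

lemma smooth_has_derivative: "smooth f \<Longrightarrow> (f has_derivative frechet_derivative f (at x)) (at x)"
  by (metis C_diff_Suc_has_derivative smooth_def)

lemma smooth_derivative: "smooth f \<Longrightarrow> smooth (\<lambda>x. frechet_derivative f (at x) v)"
  unfolding smooth_def by (metis C_diff.simps(2))

lemma smooth_continuous: "smooth f \<Longrightarrow> continuous_on UNIV f"
  unfolding smooth_def by (metis C_diff.simps(1))

text \<open>Two applications of the mean value theorem: first in direction \<open>u\<close>, to the
  \<open>v\<close>-increment of \<open>f\<close>, then in direction \<open>v\<close>, to the
  \<open>u\<close>-derivative of \<open>f\<close>.\<close>

lemma increment_second_derivative: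
  fixes f :: "'a::euclidean_space \<Rightarrow> real"
  assumes f: "smooth f" and "0 < h"
  shows "\<exists>s t. 0 < s \<and> s < h \<and> 0 < t \<and> t < h \<and>
    f (x + h *\<^sub>R u + h *\<^sub>R v) - f (x + h *\<^sub>R u) - f (x + h *\<^sub>R v) + f x
      = h * h * frechet_derivative (\<lambda>y. frechet_derivative f (at y) u) (at (x + s *\<^sub>R u + t *\<^sub>R v)) v"
proof -
  have deriv: "((\<lambda>r. g (a + r *\<^sub>R w)) has_real_derivative frechet_derivative g (at (a + r *\<^sub>R w)) w) (at r)"
    if "smooth g" for g :: "'a \<Rightarrow> real" and a w r
  proof -
    have "((\<lambda>r. a + r *\<^sub>R w) has_derivative (\<lambda>r. r *\<^sub>R w)) (at r)"
      by (auto intro!: derivative_eq_intros)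
    from has_derivative_compose[OF this smooth_has_derivative[OF that]]
    show ?thesis
      by (simp add: has_field_derivative_def mult_commute_abs
          linear_cmul[OF has_derivative_linear[OF smooth_has_derivative[OF that]]])
  qed
  let ?fu = "\<lambda>y. frechet_derivative f (at y) u"
  have "((\<lambda>s. f ((x + h *\<^sub>R v) + s *\<^sub>R u) - f (x + s *\<^sub>R u)) has_real_derivative
      ?fu ((x + h *\<^sub>R v) + s *\<^sub>R u) - ?fu (x + s *\<^sub>R u)) (at s)" for s
    by (intro DERIV_diff deriv f)
  from MVT2[OF \<open>0 < h\<close> this] obtain s where s: "0 < s" "s < h"
    "f ((x + h *\<^sub>R v) + h *\<^sub>R u) - f (x + h *\<^sub>R u) - (f ((x + h *\<^sub>R v) + 0 *\<^sub>R u) - f (x + 0 *\<^sub>R u))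
      = (h - 0) * (?fu ((x + h *\<^sub>R v) + s *\<^sub>R u) - ?fu (x + s *\<^sub>R u))"
    by blast
  from MVT2[OF \<open>0 < h\<close> deriv[OF smooth_derivative[OF f]]] obtain t where t: "0 < t" "t < h"
    "?fu ((x + s *\<^sub>R u) + h *\<^sub>R v) - ?fu ((x + s *\<^sub>R u) + 0 *\<^sub>R v)
      = (h - 0) * frechet_derivative ?fu (at ((x + s *\<^sub>R u) + t *\<^sub>R v)) v"
    by blast
  show ?thesis
    using s t by (intro exI[of _ s] exI[of _ t]) (simp add: algebra_simps)
qed

text \<open>The second difference is unchanged when \<open>u\<close> and \<open>v\<close> are
  exchanged, so the two mixed derivatives agree at points near \<open>x\<close>. As \<open>h\<close>
  tends to 0, both points tend to \<open>x\<close> and continuity gives the claim.\<close>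

lemma second_derivative_symmetric:
  fixes f :: "'a::euclidean_space \<Rightarrow> real"
  assumes f: "smooth f"
  shows "frechet_derivative (\<lambda>y. frechet_derivative f (at y) u) (at x) v
       = frechet_derivative (\<lambda>y. frechet_derivative f (at y) v) (at x) u"
proof -
  let ?D = "\<lambda>u v y. frechet_derivative (\<lambda>y. frechet_derivative f (at y) u) (at y) v"
  define h where "h n = inverse (real (Suc n))" for n
  have h: "0 < h n" for n by (simp add: h_def)
  have h0: "h \<longlonglongrightarrow> 0" unfolding h_def by (rule LIMSEQ_inverse_real_of_nat)
  let ?I = "\<lambda>n. f (x + h n *\<^sub>R u + h n *\<^sub>R v) - f (x + h n *\<^sub>R u) - f (x + h n *\<^sub>R v) + f x"
  have lim: "(\<lambda>n. ?D u v (x + s n *\<^sub>R u + t n *\<^sub>R v)) \<longlonglongrightarrow> ?D u v x"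
    if "\<forall>n. 0 < s n \<and> s n < h n \<and> 0 < t n \<and> t n < h n" for s t u v
  proof -
    have "s \<longlonglongrightarrow> 0" "t \<longlonglongrightarrow> 0"
      by (rule tendsto_sandwich[OF _ _ tendsto_const h0]; use that in \<open>auto intro: always_eventually less_imp_le\<close>)+
    then have "(\<lambda>n. x + s n *\<^sub>R u + t n *\<^sub>R v) \<longlonglongrightarrow> x + 0 *\<^sub>R u + 0 *\<^sub>R v"
      by (intro tendsto_intros)
    moreover have "isCont (?D u v) x"
      using smooth_continuous[OF smooth_derivative[OF smooth_derivative[OF f]]]
      by (simp add: continuous_on_eq_continuous_at)
    ultimately show ?thesis
      using isCont_tendsto_compose by fastforce
  qed
  have "\<exists>s t. 0 < s \<and> s < h n \<and> 0 < t \<and> t < h n \<and> ?I n = h n * h n * ?D u v (x + s *\<^sub>R u + t *\<^sub>R v)" for n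
    by (rule increment_second_derivative[OF f h])
  then obtain s t where st: "\<forall>n. 0 < s n \<and> s n < h n \<and> 0 < t n \<and> t n < h n"
    "\<And>n. ?I n = h n * h n * ?D u v (x + s n *\<^sub>R u + t n *\<^sub>R v)"
    by metis
  have "\<exists>s t. 0 < s \<and> s < h n \<and> 0 < t \<and> t < h n \<and> ?I n = h n * h n * ?D v u (x + s *\<^sub>R v + t *\<^sub>R u)" for n
    using increment_second_derivative[OF f h[of n], of x v u] by (simp add: algebra_simps)
  then obtain s' t' where st': "\<forall>n. 0 < s' n \<and> s' n < h n \<and> 0 < t' n \<and> t' n < h n"
    "\<And>n. ?I n = h n * h n * ?D v u (x + s' n *\<^sub>R v + t' n *\<^sub>R u)"
    by metis
  have "h n * h n * ?D u v (x + s n *\<^sub>R u + t n *\<^sub>R v)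
      = h n * h n * ?D v u (x + s' n *\<^sub>R v + t' n *\<^sub>R u)" for n
    using st(2) st'(2) by metis
  then have "?D u v (x + s n *\<^sub>R u + t n *\<^sub>R v) = ?D v u (x + s' n *\<^sub>R v + t' n *\<^sub>R u)" for n
    using h[of n] by (metis less_irrefl mult_cancel_left mult_eq_0_iff)
  then show ?thesis
    using LIMSEQ_unique[OF lim[OF st(1), of u v]] lim[OF st'(1), of v u] by simp
qed

subsection \<open>Poisson brackets and skew tensors\<close>

text \<open>Riesz representation in coordinates. It turns derivatives into gradients and later
  represents the functional that contains the derivative of \<open>K\<close>.\<close>

lemma linear_eq_inner_axis:
  fixes f :: "real^'n \<Rightarrow> real"
  assumes "linear f"
  shows "f v = (\<chi> i. f (axis i 1)) \<bullet> v"
proof -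
  have "f v = f (\<Sum>i\<in>UNIV. v $ i *\<^sub>R axis i 1)"
    by (simp add: basis_expansion flip: scalar_mult_eq_scaleR)
  also have "\<dots> = (\<Sum>i\<in>UNIV. v $ i * f (axis i 1))"
    using assms by (simp add: linear_sum linear_cmul)
  finally show ?thesis by (simp add: inner_vec_def mult.commute)
qed

lemma smooth_derivative_eq_grad: "smooth F \<Longrightarrow> frechet_derivative F (at x) v = grad F x \<bullet> v"
  unfolding grad_def by (rule linear_eq_inner_axis[OF has_derivative_linear[OF smooth_has_derivative]])

lemma grad_eqI:
  assumes "(F has_derivative (\<lambda>v. g \<bullet> v)) (at x)"
  shows "grad F x = g"
  using frechet_derivativeI[OF assms] by (simp add: grad_def vec_eq_iff inner_axis)

text \<open>Encoded as a map on directions, so that \<open>hessian F x\<close> is itself the Frechet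
  derivative of \<open>grad F\<close>.\<close>

definition hessian :: "(real^'n \<Rightarrow> real) \<Rightarrow> real^'n \<Rightarrow> real^'n \<Rightarrow> real^'n" where
  "hessian F x v = (\<chi> i. frechet_derivative (\<lambda>y. frechet_derivative F (at y) (axis i 1)) (at x) v)"

lemma has_derivative_grad:
  assumes "smooth F"
  shows "(grad F has_derivative hessian F x) (at x)"
proof -
  have "((\<lambda>y. grad F y \<bullet> b) has_derivative (\<lambda>v. hessian F x v \<bullet> b)) (at x)" if b: "b \<in> Basis" for b
  proof -
    obtain i where "b = axis i 1" using b by (auto simp: Basis_vec_def)
    then show ?thesis
      using smooth_has_derivative[OF smooth_derivative[OF assms, of "axis i 1"], of x]
      by (simp add: inner_axis grad_def hessian_def)
  qed
  then show ?thesis by (subst has_derivative_componentwise_within) blast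
qed

lemma hessian_symmetric:
  assumes "smooth F"
  shows "u \<bullet> hessian F x v = v \<bullet> hessian F x u"
proof -
  have *: "frechet_derivative (\<lambda>y. frechet_derivative F (at y) u) (at x) v = u \<bullet> hessian F x v" for u v
  proof -
    have "((\<lambda>y. grad F y \<bullet> u) has_derivative (\<lambda>v. hessian F x v \<bullet> u)) (at x)"
      by (intro has_derivative_inner_left has_derivative_grad assms)
    then show ?thesis
      by (simp add: smooth_derivative_eq_grad[OF assms] inner_commute frechet_derivativeI)
  qed
  show ?thesis
    using second_derivative_symmetric[OF assms, of u x v] by (simp add: *)
qed

lemma bounded_bilinear_matrix_vector_mult:
  "bounded_bilinear ((*v) :: real^'n^'m \<Rightarrow> real^'n \<Rightarrow> real^'m)"
  unfolding bilinear_conv_bounded_bilinear[symmetric] bilinear_def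
  by (auto intro!: linearI simp: matrix_vector_mult_add_rdistrib matrix_vector_mult_scaleR
      matrix_vector_right_distrib scaleR_matrix_vector_assoc)

lemma has_derivative_matrix_vector_mult_grad:
  assumes "smooth F" and "(P has_derivative P') (at x)"
  shows "((\<lambda>y. P y *v grad F y) has_derivative (\<lambda>v. P x *v hessian F x v + P' v *v grad F x)) (at x)"
  by (rule bounded_bilinear.FDERIV[OF bounded_bilinear_matrix_vector_mult assms(2) has_derivative_grad[OF assms(1)]])

lemma skew_inner:
  fixes A :: "real^'n^'n"
  assumes "transpose A = - A"
  shows "u \<bullet> (A *v v) = - ((A *v u) \<bullet> v)"
proof -
  have "u \<bullet> (A *v v) = (transpose A *v u) \<bullet> v"
    by (simp add: dot_lmul_matrix)
  also have "transpose A *v u = - (A *v u)"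
    using scaleR_matrix_vector_assoc[of "- 1" A u] by (simp add: assms)
  finally show ?thesis by simp
qed

text \<open>The second derivatives of the three functions drop out of the Jacobi sum because they are
  symmetric; what remains is a pointwise condition on the first derivative of the tensor.\<close>

lemma poisson_structureI:
  assumes "smooth P" and skew: "\<And>x. transpose (P x) = - P x"
    and P': "\<And>x. (P has_derivative P' x) (at x)"
    and cyc: "\<And>x a b c. b \<bullet> (P' x (P x *v a) *v c) + c \<bullet> (P' x (P x *v b) *v a)
                + a \<bullet> (P' x (P x *v c) *v b) = 0"
  shows "poisson_structure P"
proof -
  have iter: "bracket P F (bracket P G H) x =
      (P x *v grad G x) \<bullet> hessian H x (P x *v grad F x)
      - (P x *v grad H x) \<bullet> hessian G x (P x *v grad F x)
      - grad G x \<bullet> (P' x (P x *v grad F x) *v grad H x)"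
    if "smooth G" "smooth H" for F G H x
  proof -
    let ?X = "P x *v grad F x"
    let ?D = "\<lambda>v. grad G x \<bullet> (P x *v hessian H x v + P' x v *v grad H x)
                 + hessian G x v \<bullet> (P x *v grad H x)"
    have D: "(bracket P G H has_derivative ?D) (at x)"
      unfolding bracket_def [abs_def]
      by (intro has_derivative_inner has_derivative_grad has_derivative_matrix_vector_mult_grad that P')
    have "?D = (\<lambda>v. (\<chi> i. ?D (axis i 1)) \<bullet> v)"
      using linear_eq_inner_axis[OF has_derivative_linear[OF D]] by blast
    then have "grad (bracket P G H) x \<bullet> v = ?D v" for v
      by (metis (no_types, lifting) D grad_eqI)
    \<comment> \<open>By skewness the outer bracket is
      \<open>- (P x *v grad F x) \<bullet> grad (bracket P G H) x\<close>, that is, minus the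
      derivative of the inner bracket along \<open>?X\<close>.\<close>
    then have "bracket P F (bracket P G H) x = - ?D ?X"
      unfolding bracket_def [of P F] skew_inner[OF skew] by (simp only: inner_commute[of "P x *v _"])
    then show ?thesis
      by (simp add: inner_add_right skew_inner[OF skew, of _ x "hessian H x ?X"] inner_commute)
  qed
  have "bracket P F (bracket P G H) x + bracket P G (bracket P H F) x + bracket P H (bracket P F G) x = 0"
    if "smooth F" "smooth G" "smooth H" for F G H x
    using cyc[where x = x and a = "grad F x" and b = "grad G x" and c = "grad H x"]
      hessian_symmetric[OF that(1), of "P x *v grad G x" x "P x *v grad H x"]
      hessian_symmetric[OF that(2), of "P x *v grad F x" x "P x *v grad H x"]
      hessian_symmetric[OF that(3), of "P x *v grad F x" x "P x *v grad G x"]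
    by (simp add: iter that)
  then show ?thesis
    unfolding poisson_structure_def using assms(1) skew by blast
qed

text \<open>The Hessian enters only through the trace of a skew matrix times a symmetric one.
  Exchanging the summation indices turns this trace into its negative, so it vanishes and only the
  derivative of the tensor survives.\<close>

lemma divergence_skew_grad:
  fixes P :: "real^'n \<Rightarrow> real^'n^'n"
  assumes F: "smooth F" and skew: "transpose (P x) = - P x" and P': "(P has_derivative P') (at x)"
  shows "divergence (\<lambda>y. P y *v grad F y) x = (\<Sum>k\<in>UNIV. (P' (axis k 1) *v grad F x) $ k)"
proof -
  have "frechet_derivative (\<lambda>y. (P y *v grad F y) $ k) (at x) v
      = (P x *v hessian F x v + P' v *v grad F x) $ k" for k v
    using has_derivative_matrix_vector_mult_grad[OF F P']
    by (simp add: frechet_derivativeI[OF bounded_linear.has_derivative[OF bounded_linear_vec_nth]])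
  then have "divergence (\<lambda>y. P y *v grad F y) x =
      (\<Sum>k\<in>UNIV. (P x *v hessian F x (axis k 1)) $ k) + (\<Sum>k\<in>UNIV. (P' (axis k 1) *v grad F x) $ k)"
    by (simp add: divergence_def sum.distrib)
  moreover have "(\<Sum>k\<in>UNIV. (P x *v hessian F x (axis k 1)) $ k) = 0"
  proof -
    have h: "hessian F x (axis k 1) $ l = hessian F x (axis l 1) $ k" for k l
      using hessian_symmetric[OF F, of "axis l 1" x "axis k 1"] by (simp add: inner_axis')
    have p: "P x $ k $ l = - P x $ l $ k" for k l
      using arg_cong[OF skew, of "\<lambda>A. A $ l $ k"] by (simp add: transpose_def)
    let ?s = "\<Sum>k\<in>UNIV. \<Sum>l\<in>UNIV. P x $ k $ l * hessian F x (axis k 1) $ l"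
    have "?s = (\<Sum>l\<in>UNIV. \<Sum>k\<in>UNIV. P x $ k $ l * hessian F x (axis k 1) $ l)"
      by (rule sum.swap)
    also have "\<dots> = (\<Sum>l\<in>UNIV. \<Sum>k\<in>UNIV. - (P x $ l $ k * hessian F x (axis l 1) $ k))"
      by (intro sum.cong refl) (metis h p mult_minus_left)
    also have "\<dots> = - ?s"
      by (simp only: sum_negf)
    finally show ?thesis by (simp add: matrix_vector_mult_def)
  qed
  ultimately show ?thesis by simp
qed

text \<open>The range of a skew matrix is orthogonal to its kernel, so each independent kernel
  vector costs one dimension of the range.\<close>

lemma rank_skew_le:
  fixes A :: "real^'n^'n"
  assumes skew: "transpose A = - A" and "independent N" and ker: "\<And>a. a \<in> N \<Longrightarrow> A *v a = 0"
  shows "rank A + card N \<le> CARD('n)"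
proof -
  have ker': "A *v a = 0" if "a \<in> span N" for a
    using that by (induction rule: span_induct_alt)
      (simp_all add: ker matrix_vector_right_distrib matrix_vector_mult_scaleR)
  have "range (\<lambda>y. A *v y) \<subseteq> {y \<in> UNIV. \<forall>x\<in>span N. orthogonal x y}"
    by (auto simp: orthogonal_def skew_inner[OF skew] ker')
  then have "rank A \<le> dim {y \<in> UNIV. \<forall>x\<in>span N. orthogonal x y}"
    unfolding rank_dim_range by (rule dim_subset)
  moreover have "dim {y \<in> UNIV. \<forall>x\<in>span N. orthogonal x y} + dim (span N) = dim (UNIV :: (real^'n) set)"
    by (rule dim_subspace_orthogonal_to_vectors) auto
  moreover have "dim (span N) = card N"
    using indep_card_eq_dim_span[OF assms(2)] by simp
  ultimately show ?thesis by simp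
qed

subsection \<open>The phase space and the tensor P0\<close>

lemma sum_UNIV_Plus:
  "(\<Sum>k\<in>UNIV. f (k :: 'a::finite + 'b::finite)) = (\<Sum>i\<in>UNIV. f (Inl i)) + (\<Sum>j\<in>UNIV. f (Inr j))"
  by (simp add: sum.Plus comp_def flip: UNIV_Plus_UNIV)

lemma phase_eq_iff: "x = y \<longleftrightarrow> M_of x = M_of y \<and> gamma_of x = gamma_of y"
  by (metis join_parts(3))

lemma linear_parts:
  "M_of (x + y) = M_of x + M_of y" "gamma_of (x + y) = gamma_of x + gamma_of y"
  "M_of (x - y) = M_of x - M_of y" "gamma_of (x - y) = gamma_of x - gamma_of y"
  "M_of (c *\<^sub>R x) = c *\<^sub>R M_of x" "gamma_of (c *\<^sub>R x) = c *\<^sub>R gamma_of x"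
  "M_of 0 = 0" "gamma_of 0 = 0"
  by (simp_all add: M_of_def gamma_of_def vec_eq_iff)

lemma inner_phase: "x \<bullet> y = M_of x \<bullet> M_of y + gamma_of x \<bullet> gamma_of y" for x y :: phase
  by (simp add: inner_vec_def sum_UNIV_Plus M_of_def gamma_of_def)

lemma block_mult:
  "block A B C D *v x =
     join (A *v M_of x + B *v gamma_of x) (C *v M_of x + D *v gamma_of x)"
  by (simp add: vec_eq_iff matrix_vector_mult_def block_def join_def M_of_def gamma_of_def
      sum_UNIV_Plus split: sum.split)

lemma bounded_linear_M_of: "bounded_linear M_of"
  and bounded_linear_gamma_of: "bounded_linear gamma_of"
  by (auto simp: linear_parts simp flip: linear_conv_bounded_linear intro!: linearI)

text \<open>\<open>P0\<close> is split into two tensors linear in \<open>x\<close>, this one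
  weighted by \<open>- S_fun K x\<close>; the product rule then suffices to differentiate
  it.\<close>

definition block_gamma :: "phase \<Rightarrow> real^(3 + 3)^(3 + 3)" where
  "block_gamma x = block (hat (gamma_of x)) 0 0 0"

text \<open>The Lie-Poisson tensor of the Lie algebra e(3).\<close>

definition lie_poisson :: "phase \<Rightarrow> real^(3 + 3)^(3 + 3)" where
  "lie_poisson x = block (hat (M_of x)) (hat (gamma_of x)) (hat (gamma_of x)) 0"

lemma hat_linear: "hat (v + w) = hat v + hat w" "hat (c *\<^sub>R v) = c *\<^sub>R hat v"
  by (simp_all add: hat_def vec_eq_iff forall_3 algebra_simps)

lemma bounded_linear_block_gamma: "bounded_linear block_gamma"
  and bounded_linear_lie_poisson: "bounded_linear lie_poisson"
  by (auto simp: block_gamma_def lie_poisson_def block_def linear_parts hat_linear vec_eq_iff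
      split: sum.split simp flip: linear_conv_bounded_linear intro!: linearI)

lemma P0_eq: "P0 K x = lie_poisson x - S_fun K x *\<^sub>R block_gamma x"
  by (simp add: P0_def lie_poisson_def block_gamma_def)

lemma lie_poisson_mult:
  "lie_poisson x *v y = join (cross3 (M_of x) (M_of y) + cross3 (gamma_of x) (gamma_of y))
     (cross3 (gamma_of x) (M_of y))"
  by (simp add: lie_poisson_def block_mult hat_mult)

lemma block_gamma_mult: "block_gamma x *v y = join (cross3 (gamma_of x) (M_of y)) 0"
  by (simp add: block_gamma_def block_mult hat_mult)

lemma P0_mult:
  "P0 K x *v y = join (cross3 (M_of x - S_fun K x *\<^sub>R gamma_of x) (M_of y) + cross3 (gamma_of x) (gamma_of y))
     (cross3 (gamma_of x) (M_of y))"
  by (simp add: P0_eq matrix_vector_mult_diff_rdistrib lie_poisson_mult block_gamma_mult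
      phase_eq_iff linear_parts Cross3.left_diff_distrib cross_mult_left
      flip: scaleR_matrix_vector_assoc)

lemma vfield_eq: "vfield K H x = P0 K x *v grad H x"
  by (simp add: vfield_def Let_def P0_mult grad_M_def grad_gamma_def)

lemma transpose_P0: "transpose (P0 K x) = - P0 K x"
  by (auto simp: vec_eq_iff transpose_def P0_def block_def hat_def forall_3 split: sum.splits)

subsection \<open>Derivatives of the tensor\<close>

definition S_deriv :: "(real^3 \<Rightarrow> real^3) \<Rightarrow> phase \<Rightarrow> phase \<Rightarrow> real" where
  "S_deriv K x v = K (gamma_of x) \<bullet> M_of v
     + frechet_derivative K (at (gamma_of x)) (gamma_of v) \<bullet> M_of x"

definition P0_deriv :: "(real^3 \<Rightarrow> real^3) \<Rightarrow> phase \<Rightarrow> phase \<Rightarrow> real^(3 + 3)^(3 + 3)" where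
  "P0_deriv K x v = lie_poisson v - (S_fun K x *\<^sub>R block_gamma v + S_deriv K x v *\<^sub>R block_gamma x)"

lemma has_derivative_comp_gamma_of:
  assumes "smooth f"
  shows "((\<lambda>x. f (gamma_of x)) has_derivative
    (\<lambda>v. frechet_derivative f (at (gamma_of x)) (gamma_of v))) (at x)"
  using has_derivative_compose[OF bounded_linear_imp_has_derivative[OF bounded_linear_gamma_of]
      smooth_has_derivative[OF assms]] .

lemma has_derivative_S_fun:
  assumes "smooth K"
  shows "(S_fun K has_derivative S_deriv K x) (at x)"
  unfolding S_fun_def [abs_def] S_deriv_def [abs_def]
  by (intro has_derivative_inner has_derivative_comp_gamma_of assms
      bounded_linear_imp_has_derivative bounded_linear_M_of)

lemma has_derivative_P0:
  assumes "smooth K"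
  shows "(P0 K has_derivative P0_deriv K x) (at x)"
  unfolding P0_eq [abs_def] P0_deriv_def [abs_def]
  by (intro has_derivative_diff has_derivative_scaleR has_derivative_S_fun assms
      bounded_linear_imp_has_derivative bounded_linear_lie_poisson bounded_linear_block_gamma)

lemma smooth_P_tensor:
  assumes K: "smooth K" and \<rho>: "smooth \<rho>" "\<And>\<gamma>. \<rho> \<gamma> > 0"
  shows "smooth (P_tensor K \<rho>)"
  unfolding smooth_def
proof
  fix n
  have "C_diff n K" "C_diff n \<rho>" using K \<rho> by (auto simp: smooth_def)
  note comp = this[THEN C_diff_compose_linear[OF bounded_linear_gamma_of]]
  have "C_diff n (\<lambda>x. K (gamma_of x) \<bullet> M_of x)"
    by (rule C_diff_bilinear[OF bounded_bilinear_inner comp(1) C_diff_bounded_linear[OF bounded_linear_M_of]])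
  then have "C_diff n (\<lambda>x. - 1 *\<^sub>R (S_fun K x *\<^sub>R block_gamma x))"
    unfolding S_fun_def
    by (rule C_diff_bilinear[OF bounded_bilinear_scaleR C_diff_const
          C_diff_bilinear[OF bounded_bilinear_scaleR _ C_diff_bounded_linear[OF bounded_linear_block_gamma]]])
  from C_diff_add[OF C_diff_bounded_linear[OF bounded_linear_lie_poisson] this]
  have "C_diff n (P0 K)"
    by (simp add: P0_eq [abs_def])
  moreover have "C_diff n (\<lambda>x. inverse (\<rho> (gamma_of x)))"
    by (rule C_diff_inverse[OF _ comp(2)]) (metis \<rho>(2) less_irrefl)
  ultimately show "C_diff n (P_tensor K \<rho>)"
    unfolding P_tensor_def [abs_def] by (rule C_diff_bilinear[OF bounded_bilinear_scaleR, rotated])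
qed

lemma transpose_scaleR: "transpose (c *\<^sub>R A) = c *\<^sub>R transpose A" for A :: "real^'n^'m"
  by (simp add: transpose_def vec_eq_iff)

lemma transpose_P_tensor: "transpose (P_tensor K \<rho> x) = - P_tensor K \<rho> x"
  by (simp add: P_tensor_def transpose_scaleR transpose_P0)

subsection \<open>The invariant measure condition\<close>

text \<open>Lets sums arising in a divergence be read as a single directional derivative along
  \<open>w\<close>.\<close>

lemma sum_linear_axis_nth:
  fixes f :: "real^'n \<Rightarrow> real"
  assumes "linear f"
  shows "(\<Sum>k\<in>UNIV. f (axis k 1) * w $ k) = f w"
  using linear_eq_inner_axis[OF assms, of w] by (simp add: inner_vec_def)

text \<open>For the two linear tensors every summand vanishes, because
  \<open>cross3 (axis i 1) w\<close> has no \<open>i\<close>-th component. What remains is the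
  derivative of \<open>S_fun K\<close> along \<open>block_gamma x *v y\<close>; this vector has no
  \<gamma>-part, so the derivative of \<open>K\<close> drops out.\<close>

lemma sum_P0_deriv_axis:
  assumes "smooth K"
  shows "(\<Sum>k\<in>UNIV. (P0_deriv K x (axis k 1) *v y) $ k) = - (K (gamma_of x) \<bullet> cross3 (gamma_of x) (M_of y))"
proof -
  have "(\<Sum>k\<in>UNIV. (lie_poisson (axis k 1) *v y) $ k) = 0"
    by (simp add: sum_UNIV_Plus lie_poisson_mult join_def sum_3 cross3_def M_of_def gamma_of_def axis_def)
  moreover have "(\<Sum>k\<in>UNIV. (block_gamma (axis k 1) *v y) $ k) = 0"
    by (simp add: sum_UNIV_Plus block_gamma_mult join_def sum_3 cross3_def M_of_def gamma_of_def axis_def)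
  moreover have "(\<Sum>k\<in>UNIV. S_deriv K x (axis k 1) * (block_gamma x *v y) $ k)
      = S_deriv K x (block_gamma x *v y)"
    by (intro sum_linear_axis_nth has_derivative_linear[OF has_derivative_S_fun[OF assms]])
  moreover have "S_deriv K x (block_gamma x *v y) = K (gamma_of x) \<bullet> cross3 (gamma_of x) (M_of y)"
    using linear_0[OF has_derivative_linear[OF smooth_has_derivative[OF assms]]]
    by (simp add: S_deriv_def block_gamma_mult)
  ultimately show ?thesis
    by (simp add: P0_deriv_def matrix_vector_mult_diff_rdistrib matrix_vector_mult_add_rdistrib
        sum_subtractf sum.distrib flip: scaleR_matrix_vector_assoc sum_distrib_left)
qed

text \<open>The partial gradient in \<open>M\<close> is the affine map \<open>2 A M + b\<close>, and
  \<open>A\<close> is invertible.\<close>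

lemma grad_M_surj:
  assumes "smooth H" and "nondegenerate_quadratic (\<lambda>M. H (join M \<gamma>))"
  obtains M where "M_of (grad H (join M \<gamma>)) = u"
proof -
  obtain A b c where A: "transpose A = A" "det A \<noteq> 0" and q: "\<And>v. H (join v \<gamma>) = v \<bullet> (A *v v) + b \<bullet> v + c"
    using assms(2) unfolding nondegenerate_quadratic_def by blast
  have grad: "M_of (grad H (join v \<gamma>)) = 2 *\<^sub>R (A *v v) + b" for v
  proof -
    have "((\<lambda>v. join v \<gamma>) has_derivative (\<lambda>w. join w 0)) (at v)"
    proof -
      have "bounded_linear (\<lambda>w. join w 0)"
        by (auto simp: phase_eq_iff linear_parts simp flip: linear_conv_bounded_linear intro!: linearI)
      then have "((\<lambda>v. join v 0 + join 0 \<gamma>) has_derivative (\<lambda>w. join w 0 + 0)) (at v)"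
        by (intro has_derivative_add bounded_linear_imp_has_derivative has_derivative_const)
      moreover have "join v 0 + join 0 \<gamma> = join v \<gamma>" for v
        by (simp add: phase_eq_iff linear_parts)
      ultimately show ?thesis by simp
    qed
    from has_derivative_compose[OF this smooth_has_derivative[OF assms(1)]]
    have "((\<lambda>v. H (join v \<gamma>)) has_derivative (\<lambda>w. M_of (grad H (join v \<gamma>)) \<bullet> w)) (at v)"
      by (simp add: smooth_derivative_eq_grad[OF assms(1)] inner_phase)
    moreover have "((\<lambda>v. H (join v \<gamma>)) has_derivative (\<lambda>w. (2 *\<^sub>R (A *v v) + b) \<bullet> w)) (at v)"
    proof -
      have "v \<bullet> (A *v w) = (A *v v) \<bullet> w" for w
        by (metis A(1) dot_lmul_matrix transpose_matrix_vector)
      moreover have "((\<lambda>v. v \<bullet> (A *v v) + b \<bullet> v + c) has_derivative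
          (\<lambda>w. v \<bullet> (A *v w) + w \<bullet> (A *v v) + b \<bullet> w + 0)) (at v)"
        by (intro has_derivative_add has_derivative_inner has_derivative_inner_right has_derivative_const
            has_derivative_ident bounded_linear_imp_has_derivative matrix_vector_mul_bounded_linear)
      ultimately show ?thesis
        unfolding q by (simp add: inner_add_left inner_add_right inner_commute)
    qed
    ultimately show ?thesis by (metis grad_eqI)
  qed
  obtain B where "A ** B = mat 1"
    using A(2) by (metis invertible_def invertible_det_nz)
  then have "A *v (B *v w) = w" for w
    by (simp add: matrix_vector_mul_assoc)
  then have "M_of (grad H (join (B *v ((1/2) *\<^sub>R (u - b))) \<gamma>)) = u"
    by (simp add: grad)
  then show ?thesis by (rule that)
qed

text \<open>The vanishing divergence of \<open>\<rho> V\<close> is evaluated at a point over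
  \<gamma> where the partial gradient of \<open>H\<close> in \<open>M\<close> equals
  \<open>u\<close>. The density is differentiated along the \<gamma>-part of the field, which there
  is \<open>cross3 \<gamma> u\<close>.\<close>

lemma density_derivative:
  assumes H: "smooth H" and K: "smooth K" and \<rho>: "smooth \<rho>"
    and nondeg: "nondegenerate_quadratic (\<lambda>M. H (join M \<gamma>))"
    and inv: "invariant_density (vfield K H) (\<lambda>x. \<rho> (gamma_of x))"
  shows "frechet_derivative \<rho> (at \<gamma>) (cross3 \<gamma> u) = \<rho> \<gamma> * (K \<gamma> \<bullet> cross3 \<gamma> u)"
proof -
  obtain M where M: "M_of (grad H (join M \<gamma>)) = u"
    using grad_M_surj[OF H nondeg] by blast
  define x where "x = join M \<gamma>"
  let ?D = "frechet_derivative \<rho> (at \<gamma>)"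
  let ?Q = "\<lambda>y. \<rho> (gamma_of y) *\<^sub>R P0 K y"
  have \<gamma>: "gamma_of x = \<gamma>" by (simp add: x_def)
  have Q': "(?Q has_derivative (\<lambda>v. \<rho> \<gamma> *\<^sub>R P0_deriv K x v + ?D (gamma_of v) *\<^sub>R P0 K x)) (at x)"
    using has_derivative_scaleR[OF has_derivative_comp_gamma_of[OF \<rho>, of x] has_derivative_P0[OF K, of x]]
    by (simp add: \<gamma>)
  have "0 = divergence (\<lambda>y. \<rho> (gamma_of y) *\<^sub>R vfield K H y) x"
    using inv by (simp add: invariant_density_def)
  \<comment> \<open>The density is absorbed into the tensor, which stays skew, so that
    \<open>divergence_skew_grad\<close> applies.\<close>
  also have "\<dots> = divergence (\<lambda>y. ?Q y *v grad H y) x"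
    by (simp add: vfield_eq scaleR_matrix_vector_assoc)
  also have "\<dots> = (\<Sum>k\<in>UNIV. ((\<rho> \<gamma> *\<^sub>R P0_deriv K x (axis k 1)
      + ?D (gamma_of (axis k 1)) *\<^sub>R P0 K x) *v grad H x) $ k)"
    by (rule divergence_skew_grad[OF H _ Q']) (simp add: transpose_scaleR transpose_P0)
  also have "\<dots> = \<rho> \<gamma> * (\<Sum>k\<in>UNIV. (P0_deriv K x (axis k 1) *v grad H x) $ k)
      + (\<Sum>k\<in>UNIV. ?D (gamma_of (axis k 1)) * (P0 K x *v grad H x) $ k)"
    by (simp add: matrix_vector_mult_add_rdistrib sum.distrib sum_distrib_left
        flip: scaleR_matrix_vector_assoc)
  also have "(\<Sum>k\<in>UNIV. ?D (gamma_of (axis k 1)) * (P0 K x *v grad H x) $ k)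
      = ?D (gamma_of (P0 K x *v grad H x))"
    by (intro sum_linear_axis_nth)
      (use has_derivative_linear[OF has_derivative_comp_gamma_of[OF \<rho>, of x]] \<gamma> in simp)
  finally show ?thesis
    using M by (simp add: sum_P0_deriv_axis[OF K] P0_mult \<gamma> flip: x_def)
qed

subsection \<open>The Jacobi identity\<close>

text \<open>The five identities are the homogeneous parts of the Jacobi condition for \<open>P_tensor\<close>, with
  \<open>a = (u\<^sub>1, v\<^sub>1)\<close>, \<open>b = (u\<^sub>2, v\<^sub>2)\<close>, \<open>c = (u\<^sub>3, v\<^sub>3)\<close>. The first two express
  the Jacobi identity of the Lie-Poisson bracket of e(3), the third contains the derivative of \<open>K\<close>,
  and the last two the terms linear in \<open>K\<close>, half of which come from the conformal factor.\<close>

lemma cyclic_cross: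
  "u2 \<bullet> cross3 (cross3 N u1) u3 + u3 \<bullet> cross3 (cross3 N u2) u1 + u1 \<bullet> cross3 (cross3 N u3) u2 = 0"
  by (simp add: cross3_simps)

lemma cyclic_cross_mixed:
  "(u2 \<bullet> cross3 (cross3 g v1) u3 + u2 \<bullet> cross3 (cross3 g u1) v3 + v2 \<bullet> cross3 (cross3 g u1) u3)
   + (u3 \<bullet> cross3 (cross3 g v2) u1 + u3 \<bullet> cross3 (cross3 g u2) v1 + v3 \<bullet> cross3 (cross3 g u2) u1)
   + (u1 \<bullet> cross3 (cross3 g v3) u2 + u1 \<bullet> cross3 (cross3 g u3) v2 + v1 \<bullet> cross3 (cross3 g u3) u2) = 0"
  by (simp add: cross3_simps)

lemma cyclic_inner_cross:
  "(d \<bullet> cross3 g u1) * (u2 \<bullet> cross3 g u3) + (d \<bullet> cross3 g u2) * (u3 \<bullet> cross3 g u1)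
   + (d \<bullet> cross3 g u3) * (u1 \<bullet> cross3 g u2) = 0"
  \<comment> \<open>With \<open>w = cross3 d g\<close>, Cramer's rule for \<open>u1, u2, u3\<close>
    makes the sum equal to \<open>- det(u1,u2,u3) (w \<bullet> g)\<close>, and \<open>w\<close> is
    orthogonal to \<open>g\<close>.\<close>
  by (simp add: cross3_simps)

lemma cyclic_inner_cross_polarized:
  "((k \<bullet> cross3 g u1) * (u2 \<bullet> cross3 N u3) + (k \<bullet> cross3 N u1) * (u2 \<bullet> cross3 g u3))
   + ((k \<bullet> cross3 g u2) * (u3 \<bullet> cross3 N u1) + (k \<bullet> cross3 N u2) * (u3 \<bullet> cross3 g u1))
   + ((k \<bullet> cross3 g u3) * (u1 \<bullet> cross3 N u2) + (k \<bullet> cross3 N u3) * (u1 \<bullet> cross3 g u2)) = 0"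
  \<comment> \<open>Polarization: the previous identity is quadratic in \<open>g\<close>, and this
    sum is its polar form in \<open>g\<close> and \<open>N\<close>.\<close>
  using cyclic_inner_cross[of k "g + N" u1 u2 u3] cyclic_inner_cross[of k g u1 u2 u3]
    cyclic_inner_cross[of k N u1 u2 u3]
  by (simp add: cross_add_left algebra_simps)

lemma cyclic_inner_cross_mixed:
  "((k \<bullet> cross3 g u1) * (u2 \<bullet> cross3 g v3 + v2 \<bullet> cross3 g u3) + (k \<bullet> cross3 g v1) * (u2 \<bullet> cross3 g u3))
   + ((k \<bullet> cross3 g u2) * (u3 \<bullet> cross3 g v1 + v3 \<bullet> cross3 g u1) + (k \<bullet> cross3 g v2) * (u3 \<bullet> cross3 g u1))
   + ((k \<bullet> cross3 g u3) * (u1 \<bullet> cross3 g v2 + v1 \<bullet> cross3 g u2) + (k \<bullet> cross3 g v3) * (u1 \<bullet> cross3 g u2)) = 0"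
  \<comment> \<open>The identity is trilinear in \<open>u1, u2, u3\<close>; the claimed sum adds its
    three instances with exactly one \<open>u\<close> replaced by the corresponding
    \<open>v\<close>.\<close>
  using cyclic_inner_cross[of k g "u1 + v1" "u2 + v2" "u3 + v3"]
    cyclic_inner_cross[of k g "u1 - v1" "u2 - v2" "u3 - v3"]
    cyclic_inner_cross[of k g v1 u2 u3] cyclic_inner_cross[of k g u1 v2 u3]
    cyclic_inner_cross[of k g u1 u2 v3]
  by (simp add: cross_add_right algebra_simps)

section \<open>The Jacobi condition for the rescaled tensor\<close>

definition P_tensor_deriv ::
  "(real^3 \<Rightarrow> real^3) \<Rightarrow> (real^3 \<Rightarrow> real) \<Rightarrow> phase \<Rightarrow> phase \<Rightarrow> real^(3 + 3)^(3 + 3)" where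
  "P_tensor_deriv K \<rho> x v = inverse (\<rho> (gamma_of x)) *\<^sub>R P0_deriv K x v
     + (- (inverse (\<rho> (gamma_of x)) * frechet_derivative \<rho> (at (gamma_of x)) (gamma_of v)
            * inverse (\<rho> (gamma_of x)))) *\<^sub>R P0 K x"

lemma has_derivative_P_tensor:
  assumes "smooth K" "smooth \<rho>" "\<And>\<gamma>. \<rho> \<gamma> > 0"
  shows "(P_tensor K \<rho> has_derivative P_tensor_deriv K \<rho> x) (at x)"
proof -
  have "\<rho> (gamma_of x) \<noteq> 0" using assms(3) by (simp add: less_imp_neq[symmetric])
  then show ?thesis
    unfolding P_tensor_def [abs_def] P_tensor_deriv_def [abs_def]
    by (intro has_derivative_scaleR has_derivative_P0 assms Deriv.has_derivative_inverse
        has_derivative_comp_gamma_of)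
qed

text \<open>Expands one of the three cyclic terms into the pieces matched by the identities above.
  The \<gamma>-part of \<open>P0 K x *v a\<close> is \<open>cross3 g u1\<close>, so
  \<open>dens\<close> replaces the derivative of \<open>\<rho>\<close> by \<open>\<rho> K\<close>;
  the density survives only in the common factor. \<open>N\<close> absorbs the \<open>S\<close> term
  into \<open>M\<close>.\<close>

lemma inner_P_tensor_deriv:
  fixes a b c x :: phase
  assumes K: "smooth K" and \<rho>: "smooth \<rho>" "\<And>\<gamma>. \<rho> \<gamma> > 0"
    and dens: "\<And>\<gamma> u. frechet_derivative \<rho> (at \<gamma>) (cross3 \<gamma> u) = \<rho> \<gamma> * (K \<gamma> \<bullet> cross3 \<gamma> u)"
    and d: "\<And>w. frechet_derivative K (at (gamma_of x)) w \<bullet> M_of x = d \<bullet> w"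
  defines "g \<equiv> gamma_of x" and "s \<equiv> S_fun K x" and "N \<equiv> M_of x - S_fun K x *\<^sub>R gamma_of x"
    and "u1 \<equiv> M_of a" and "v1 \<equiv> gamma_of a"
    and "u2 \<equiv> M_of b" and "v2 \<equiv> gamma_of b"
    and "u3 \<equiv> M_of c" and "v3 \<equiv> gamma_of c"
  shows "b \<bullet> (P_tensor_deriv K \<rho> x (P_tensor K \<rho> x *v a) *v c) =
    inverse (\<rho> g) * inverse (\<rho> g) *
     (u2 \<bullet> cross3 (cross3 N u1) u3 - s * (u2 \<bullet> cross3 (cross3 g u1) u3)
      + (u2 \<bullet> cross3 (cross3 g v1) u3 + u2 \<bullet> cross3 (cross3 g u1) v3 + v2 \<bullet> cross3 (cross3 g u1) u3)
      - (d \<bullet> cross3 g u1) * (u2 \<bullet> cross3 g u3)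
      - ((K g \<bullet> cross3 g u1) * (u2 \<bullet> cross3 N u3) + (K g \<bullet> cross3 N u1) * (u2 \<bullet> cross3 g u3))
      - ((K g \<bullet> cross3 g u1) * (u2 \<bullet> cross3 g v3 + v2 \<bullet> cross3 g u3) + (K g \<bullet> cross3 g v1) * (u2 \<bullet> cross3 g u3)))"
proof -
  define r where "r = inverse (\<rho> g)"
  note d' = d[folded g_def]
  have r: "r * \<rho> g = 1" using \<rho>(2)[of g] by (simp add: r_def)
  let ?X = "P0 K x *v a"
  have MX: "M_of ?X = cross3 N u1 + cross3 g v1" and gX: "gamma_of ?X = cross3 g u1"
    by (simp_all add: P0_mult N_def u1_def g_def v1_def)
  have "P_tensor K \<rho> x *v a = r *\<^sub>R ?X"
    by (simp add: P_tensor_def r_def g_def scaleR_matrix_vector_assoc)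
  then have "P_tensor_deriv K \<rho> x (P_tensor K \<rho> x *v a) = r *\<^sub>R P_tensor_deriv K \<rho> x ?X"
    by (simp add: linear_cmul[OF has_derivative_linear[OF has_derivative_P_tensor[OF K \<rho>]]])
  moreover have "P_tensor_deriv K \<rho> x ?X = r *\<^sub>R (P0_deriv K x ?X - (K g \<bullet> cross3 g u1) *\<^sub>R P0 K x)"
  proof -
    have "r * frechet_derivative \<rho> (at g) (gamma_of ?X) * r = r * (K g \<bullet> cross3 g u1)"
      using r by (simp add: gX dens mult.commute mult.left_commute)
    then show ?thesis
      by (simp add: P_tensor_deriv_def scaleR_right_diff_distrib flip: r_def g_def)
  qed
  moreover have "b \<bullet> (P0_deriv K x ?X *v c) =
      u2 \<bullet> cross3 (cross3 N u1 + cross3 g v1) u3 + u2 \<bullet> cross3 (cross3 g u1) v3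
      + v2 \<bullet> cross3 (cross3 g u1) u3 - s * (u2 \<bullet> cross3 (cross3 g u1) u3)
      - (K g \<bullet> (cross3 N u1 + cross3 g v1) + d \<bullet> cross3 g u1) * (u2 \<bullet> cross3 g u3)"
    by (simp add: P0_deriv_def inner_phase lie_poisson_mult block_gamma_mult MX gX
        S_deriv_def d' linear_parts algebra_simps
        flip: scaleR_matrix_vector_assoc g_def s_def u2_def u3_def v2_def v3_def)
  moreover have "b \<bullet> (P0 K x *v c) = u2 \<bullet> cross3 N u3 + u2 \<bullet> cross3 g v3 + v2 \<bullet> cross3 g u3"
    by (simp add: P0_mult inner_phase inner_add_right N_def g_def u2_def u3_def v2_def v3_def)
  ultimately have "b \<bullet> (P_tensor_deriv K \<rho> x (P_tensor K \<rho> x *v a) *v c) = r * (r *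
     (u2 \<bullet> cross3 (cross3 N u1 + cross3 g v1) u3 + u2 \<bullet> cross3 (cross3 g u1) v3
      + v2 \<bullet> cross3 (cross3 g u1) u3 - s * (u2 \<bullet> cross3 (cross3 g u1) u3)
      - (K g \<bullet> (cross3 N u1 + cross3 g v1) + d \<bullet> cross3 g u1) * (u2 \<bullet> cross3 g u3)
      - (K g \<bullet> cross3 g u1) * (u2 \<bullet> cross3 N u3 + u2 \<bullet> cross3 g v3 + v2 \<bullet> cross3 g u3)))"
    by (simp add: matrix_vector_mult_diff_rdistrib inner_diff_right
        flip: scaleR_matrix_vector_assoc)
  then show ?thesis
    unfolding r_def[symmetric] by (simp add: cross_add_left algebra_simps)
qed

lemma poisson_structure_P_tensor:
  assumes K: "smooth K" and \<rho>: "smooth \<rho>" "\<And>\<gamma>. \<rho> \<gamma> > 0"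
    and dens: "\<And>\<gamma> u. frechet_derivative \<rho> (at \<gamma>) (cross3 \<gamma> u) = \<rho> \<gamma> * (K \<gamma> \<bullet> cross3 \<gamma> u)"
  shows "poisson_structure (P_tensor K \<rho>)"
proof (rule poisson_structureI[OF smooth_P_tensor[OF K \<rho>] transpose_P_tensor has_derivative_P_tensor[OF K \<rho>]])
  fix x a b c :: phase
  obtain d where d: "\<And>w. frechet_derivative K (at (gamma_of x)) w \<bullet> M_of x = d \<bullet> w"
  proof
    show "frechet_derivative K (at (gamma_of x)) w \<bullet> M_of x
        = (\<chi> i. frechet_derivative K (at (gamma_of x)) (axis i 1) \<bullet> M_of x) \<bullet> w" for w
      by (rule linear_eq_inner_axis[of "\<lambda>w. frechet_derivative K (at (gamma_of x)) w \<bullet> M_of x"])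
        (intro linear_compose[OF has_derivative_linear[OF smooth_has_derivative[OF K]], unfolded comp_def]
          bounded_linear.linear[OF bounded_linear_inner_left])
  qed
  define g where "g = gamma_of x"
  define s where "s = S_fun K x"
  define N where "N = M_of x - s *\<^sub>R g"
  define k where "k = K g"
  note E = inner_P_tensor_deriv[OF K \<rho> dens d, folded g_def s_def, folded N_def k_def]
  \<comment> \<open>All three terms share the factor \<open>1/\<rho>^2\<close>; stripping it leaves
    a linear combination of the cyclic identities.\<close>
  have factor: "r * e1 + r * e2 + r * e3 = 0" if "e1 + e2 + e3 = 0" for r e1 e2 e3 :: real
    using that by (metis distrib_left mult_zero_right)
  show "b \<bullet> (P_tensor_deriv K \<rho> x (P_tensor K \<rho> x *v a) *v c)
      + c \<bullet> (P_tensor_deriv K \<rho> x (P_tensor K \<rho> x *v b) *v a)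
      + a \<bullet> (P_tensor_deriv K \<rho> x (P_tensor K \<rho> x *v c) *v b) = 0"
    \<comment> \<open>Linear arithmetic treats products as atoms, so the instance of
      \<open>cyclic_cross\<close> at \<open>g\<close> is multiplied by \<open>s\<close>
      beforehand.\<close>
    unfolding E
    by (rule factor)
      (use cyclic_cross[of "M_of b" N "M_of a" "M_of c"]
      arg_cong[OF cyclic_cross[of "M_of b" g "M_of a" "M_of c"], of "(*) s", unfolded distrib_left mult_zero_right]
      cyclic_cross_mixed[of "M_of b" g "gamma_of a" "M_of c" "M_of a" "gamma_of c" "gamma_of b"]
      cyclic_inner_cross[of d g "M_of a" "M_of b" "M_of c"]
      cyclic_inner_cross_polarized[of k g "M_of a" "M_of b" N "M_of c"]
      cyclic_inner_cross_mixed[of k g "M_of a" "M_of b" "gamma_of c" "gamma_of b" "M_of c" "gamma_of a"]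
      in linarith)
qed

subsection \<open>Casimir functions and rank\<close>

lemma P_tensor_mult: "P_tensor K \<rho> x *v y = inverse (\<rho> (gamma_of x)) *\<^sub>R (P0 K x *v y)"
  by (simp add: P_tensor_def scaleR_matrix_vector_assoc)

text \<open>The scalar covers both the gradient of the first Casimir function (\<open>c = 2\<close>)
  and the kernel vector of the rank bound (\<open>c = 1\<close>).\<close>

lemma P0_mult_grad_F1: "P0 K x *v join 0 (c *\<^sub>R gamma_of x) = 0"
  by (simp add: P0_mult phase_eq_iff linear_parts cross_mult_right)

text \<open>The \<open>S\<close> term dies in \<open>cross3 \<gamma> \<gamma>\<close>, and the two
  remaining products of \<open>M\<close> and \<gamma> cancel by antisymmetry.\<close>

lemma P0_mult_grad_F2: "P0 K x *v join (gamma_of x) (M_of x) = 0"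
  by (simp add: P0_mult phase_eq_iff linear_parts Cross3.left_diff_distrib cross_mult_left
      cross_skew[of "M_of x"])

lemma casimir_P_tensor:
  shows "casimir (P_tensor K \<rho>) (\<lambda>x. gamma_of x \<bullet> gamma_of x)" (is "casimir _ ?F1")
    and "casimir (P_tensor K \<rho>) (\<lambda>x. M_of x \<bullet> gamma_of x)" (is "casimir _ ?F2")
proof -
  have "smooth ?F1" "smooth ?F2"
    unfolding smooth_def
    by (intro allI C_diff_bilinear[OF bounded_bilinear_inner] C_diff_bounded_linear
        bounded_linear_M_of bounded_linear_gamma_of)+
  moreover have "grad ?F1 x = join 0 (2 *\<^sub>R gamma_of x)" for x
  proof (rule grad_eqI)
    have "(?F1 has_derivative (\<lambda>v. gamma_of x \<bullet> gamma_of v + gamma_of v \<bullet> gamma_of x)) (at x)"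
      by (intro has_derivative_inner bounded_linear_imp_has_derivative bounded_linear_gamma_of)
    then show "(?F1 has_derivative (\<lambda>v. join 0 (2 *\<^sub>R gamma_of x) \<bullet> v)) (at x)"
      by (simp add: inner_phase inner_commute)
  qed
  moreover have "grad ?F2 x = join (gamma_of x) (M_of x)" for x
  proof (rule grad_eqI)
    have "(?F2 has_derivative (\<lambda>v. M_of x \<bullet> gamma_of v + M_of v \<bullet> gamma_of x)) (at x)"
      by (intro has_derivative_inner bounded_linear_imp_has_derivative bounded_linear_gamma_of bounded_linear_M_of)
    then show "(?F2 has_derivative (\<lambda>v. join (gamma_of x) (M_of x) \<bullet> v)) (at x)"
      by (simp add: inner_phase inner_commute add.commute)
  qed
  ultimately show "casimir (P_tensor K \<rho>) ?F1" "casimir (P_tensor K \<rho>) ?F2"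
    by (simp_all add: casimir_def P_tensor_mult P0_mult_grad_F1 P0_mult_grad_F2)
qed

section \<open>The rank of the tensor\<close>

lemma independent_pair:
  fixes a b :: "'a::real_vector"
  assumes "b \<noteq> 0" and "\<And>c. a \<noteq> c *\<^sub>R b"
  shows "independent {a, b}" "card {a, b} = 2"
proof -
  show "independent {a, b}"
    using assms by (auto simp: independent_insert span_singleton)
  have "a \<noteq> b" using assms(2)[of 1] by simp
  then show "card {a, b} = 2" by simp
qed

lemma rank_P_tensor_le: "rank (P_tensor K \<rho> x) \<le> 4"
proof -
  have "\<exists>a b :: phase. b \<noteq> 0 \<and> (\<forall>c. a \<noteq> c *\<^sub>R b) \<and> P0 K x *v a = 0 \<and> P0 K x *v b = 0"
  proof (cases "gamma_of x = 0")
    \<comment> \<open>Here the Casimir gradients become dependent, but the tensor annihilates every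
      vector without \<open>M\<close>-part.\<close>
    case True
    have "axis 1 1 \<noteq> c *\<^sub>R (axis 2 1 :: real^3)" for c
      by (auto simp: axis_def vec_eq_iff intro!: exI[of _ 1])
    then show ?thesis
      using True by (intro exI[of _ "join 0 (axis 1 1)"] exI[of _ "join 0 (axis 2 1)"])
        (auto simp: P0_mult phase_eq_iff linear_parts)
  next
    \<comment> \<open>The Casimir gradients, up to scaling, serve: \<open>b\<close> has
      \<open>M\<close>-part \<gamma>, nonzero here, and \<open>a\<close> has none, so
      \<open>a = c b\<close> would force \<open>c = 0\<close> and then
      \<open>\<gamma> = 0\<close>.\<close>
    case False
    then show ?thesis
      using P0_mult_grad_F1[of K x 1] P0_mult_grad_F2[of K x]
      by (intro exI[of _ "join 0 (gamma_of x)"] exI[of _ "join (gamma_of x) (M_of x)"])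
        (auto simp: phase_eq_iff linear_parts)
  qed
  then obtain a b :: phase where ab: "b \<noteq> 0" "\<And>c. a \<noteq> c *\<^sub>R b" "P0 K x *v a = 0" "P0 K x *v b = 0"
    by blast
  have "rank (P_tensor K \<rho> x) + card {a, b} \<le> CARD(3 + 3)"
    by (rule rank_skew_le[OF transpose_P_tensor independent_pair(1)[OF ab(1,2)]])
      (use ab in \<open>auto simp: P_tensor_mult\<close>)
  then show ?thesis
    using independent_pair(2)[OF ab(1,2)] by simp
qed

lemma rank_P_tensor_ge:
  assumes "\<And>\<gamma>. \<rho> \<gamma> > 0"
  shows "4 \<le> rank (P_tensor K \<rho> (join 0 (axis 1 1)))"
proof -
  let ?x = "join 0 (axis 1 1)" and ?r = "inverse (\<rho> (axis 1 1))"
  let ?B = "{axis (Inl 2) 1, axis (Inl 3) 1, axis (Inr 2) 1, axis (Inr 3) 1} :: phase set"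
  have r: "\<rho> (axis 1 1) \<noteq> 0" using assms[of "axis 1 1"] by simp
  \<comment> \<open>At \<open>M = 0\<close> also \<open>S_fun\<close> vanishes, and the scaling of
    the argument cancels \<open>1/\<rho>\<close>. The tensor then acts by the cross product with
    \<open>axis 1 1\<close> from each block into the other.\<close>
  have *: "P_tensor K \<rho> ?x *v (\<rho> (axis 1 1) *\<^sub>R join u v) = join (cross3 (axis 1 1) v) (cross3 (axis 1 1) u)" for u v
    using r by (simp add: P_tensor_mult P0_mult matrix_vector_mult_scaleR S_fun_def)
  have ax: "join (axis i 1) 0 = axis (Inl i) 1" "join 0 (axis i 1) = axis (Inr i) 1" for i
    by (auto simp: join_def axis_def vec_eq_iff split: sum.splits)
  have "?B \<subseteq> range ((*v) (P_tensor K \<rho> ?x))"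
  proof -
    have "axis (Inl 2) 1 = P_tensor K \<rho> ?x *v (\<rho> (axis 1 1) *\<^sub>R join 0 (- axis 3 1))"
      "axis (Inl 3) 1 = P_tensor K \<rho> ?x *v (\<rho> (axis 1 1) *\<^sub>R join 0 (axis 2 1))"
      "axis (Inr 2) 1 = P_tensor K \<rho> ?x *v (\<rho> (axis 1 1) *\<^sub>R join (- axis 3 1) 0)"
      "axis (Inr 3) 1 = P_tensor K \<rho> ?x *v (\<rho> (axis 1 1) *\<^sub>R join (axis 2 1) 0)"
      unfolding * by (simp_all add: cross_basis ax)
    then show ?thesis by blast
  qed
  moreover have "independent ?B"
    by (rule independent_mono[OF independent_Basis]) (auto simp: Basis_vec_def)
  moreover have "card ?B = 4"
    by (simp add: axis_eq_axis)
  ultimately show ?thesis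
    unfolding rank_dim_range using independent_card_le_dim by metis
qed

lemma poisson_rank_P_tensor:
  assumes "\<And>\<gamma>. \<rho> \<gamma> > 0"
  shows "poisson_rank (P_tensor K \<rho>) = 4"
  unfolding poisson_rank_def
proof (rule Max_eqI)
  show "finite (range (\<lambda>x. rank (P_tensor K \<rho> x)))"
    by (rule finite_subset[of _ "{..4}"]) (auto simp: rank_P_tensor_le)
  show "y \<le> 4" if "y \<in> range (\<lambda>x. rank (P_tensor K \<rho> x))" for y
    using that rank_P_tensor_le by auto
  show "4 \<in> range (\<lambda>x. rank (P_tensor K \<rho> x))"
    using rank_P_tensor_ge[of \<rho> K] rank_P_tensor_le[of K \<rho> "join 0 (axis 1 1)"] assms
    by (intro range_eqI[of _ _ "join 0 (axis 1 1)"]) (auto intro: antisym)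
qed

theorem theorem2:
  fixes H :: "phase \<Rightarrow> real"
    and K :: "real^3 \<Rightarrow> real^3"
    and \<rho> :: "real^3 \<Rightarrow> real"
  assumes "smooth H" and "smooth K" and "smooth \<rho>"
    and "\<And>\<gamma>. \<rho> \<gamma> > 0"
    and "\<And>\<gamma>. nondegenerate_quadratic (\<lambda>M. H (join M \<gamma>))"
    and "invariant_density (vfield K H) (\<lambda>x. \<rho> (gamma_of x))"
  shows "(\<forall>x. vfield K H x = \<rho> (gamma_of x) *\<^sub>R (P_tensor K \<rho> x *v grad H x))
    \<and> poisson_structure (P_tensor K \<rho>)
    \<and> poisson_rank (P_tensor K \<rho>) = 4
    \<and> casimir (P_tensor K \<rho>) (\<lambda>x. gamma_of x \<bullet> gamma_of x)
    \<and> casimir (P_tensor K \<rho>) (\<lambda>x. M_of x \<bullet> gamma_of x)"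
proof (intro conjI allI)
  show "vfield K H x = \<rho> (gamma_of x) *\<^sub>R (P_tensor K \<rho> x *v grad H x)" for x
    using assms(4)[of "gamma_of x"] by (simp add: P_tensor_mult vfield_eq)
  show "poisson_structure (P_tensor K \<rho>)"
    \<comment> \<open>Invariance of the measure and non-degeneracy enter through
      \<open>density_derivative\<close>.\<close>
    by (rule poisson_structure_P_tensor[OF assms(2-4) density_derivative[OF assms(1-3,5,6)]])
qed (rule poisson_rank_P_tensor[OF assms(4)] casimir_P_tensor)+

end
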